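(* Let $m \geq 2$ be an even integer and let $G$ and $H$ be $m$-edge-coloured graphs. Then $G$ and $H$ are $D_m$-switch equivalent if and only if the $2$-edge-coloured graphs $G_2$ and $H_2$ are $S_2$-switch equivalent.
   Context: Graphs are finite, undirected and simple (no loops, no multiple edges). An $m$-edge-coloured graph is a pair $G=(F,\Sigma)$ where $F$ is a graph and $\Sigma: E(F)\to\{1,\dots,m\}$ is any function; $\Sigma(e)$ is the colour of $e$. We write $\mathit{underlying}(G)=F$ and $\Sigma(G)=\Sigma$. An isomorphism of $m$-edge-coloured graphs is an isomorphism of the underlying graphs that preserves edge colours. $S_m$ is the symmetric group on $\{1,\dots,m\}$. For $m\ge 3$, $D_m\le S_m$ is the group of permutations of $\{1,\dots,m\}$ corresponding to symmetries of the regular $m$-gon with vertices $1,2,\dots,m$ in cyclic order; $D_2=S_2$. Let $\Gamma$ be a subgroup of $S_m$. For a vertex $x$ of $G$ and $\pi\in\Gamma$, switching at $x$ with respect to $\pi$ transforms $G$ into the $m$-edge-coloured graph $G^{(x,\pi)}$ with the same underlying graph, in which each edge $xy$ incident with $x$ has colour $\pi(\Sigma(G)(xy))$ and all other edges keep their colours. A $\Gamma$-switching sequence is a finite sequence $\mathcal{S}=(x_1,\pi_1),\dots,(x_t,\pi_t)$ of elements of $V(G)\times\Gamma$, and $G^{\mathcal{S}}$ is the result of performing these switches successively in order. $G$ and $H$ are $\Gamma$-switch equivalent if there is a $\Gamma$-switching sequence $\mathcal{S}$ with $G^{\mathcal{S}}\cong H$ (isomorphism of $m$-edge-coloured graphs).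 For $m$ even, let $\mathcal{E}=\{2,4,\dots,m\}$ and $\mathcal{O}=\{1,3,\dots,m-1\}$. For an $m$-edge-coloured graph $G$, the $2$-edge-coloured graph $G_2$ has the same underlying graph as $G$, and an edge $e$ has colour $1$ in $G_2$ if $\Sigma(G)(e)\in\mathcal{O}$ and colour $2$ if $\Sigma(G)(e)\in\mathcal{E}$. *)

theory Defs
  imports Complex_Main "HOL-Algebra.Sym_Groups"
begin

record 'a ecgraph =
  verts :: "'a set"
  edges :: "'a set set"
  colour :: "'a set \<Rightarrow> nat"

text \<open>
  Edges are two-element sets of vertices, so that the graph is undirected, loopless and without
  multiple edges. The value of \<open>colour\<close> on sets that are not edges is irrelevant; no notion below
  depends on it.
\<close>

definition edge_coloured_graph :: "nat \<Rightarrow> 'a ecgraph \<Rightarrow> bool" where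
  "edge_coloured_graph m G \<longleftrightarrow>
     finite (verts G) \<and>
     (\<forall>e\<in>edges G. e \<subseteq> verts G \<and> card e = 2) \<and>
     (\<forall>e\<in>edges G. colour G e \<in> {1..m})"

definition isomorphic :: "'a ecgraph \<Rightarrow> 'b ecgraph \<Rightarrow> bool" where
  "isomorphic G H \<longleftrightarrow>
     (\<exists>f. bij_betw f (verts G) (verts H) \<and>
          (\<forall>x\<in>verts G. \<forall>y\<in>verts G. {x, y} \<in> edges G \<longleftrightarrow> {f x, f y} \<in> edges H) \<and>
          (\<forall>x\<in>verts G. \<forall>y\<in>verts G.
             {x, y} \<in> edges G \<longrightarrow> colour H {f x, f y} = colour G {x, y}))"

definition switch :: "'a \<times> (nat \<Rightarrow> nat) \<Rightarrow> 'a ecgraph \<Rightarrow> 'a ecgraph" where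
  "switch = (\<lambda>(x, \<pi>) G.
     G\<lparr>colour := (\<lambda>e. if e \<in> edges G \<and> x \<in> e then \<pi> (colour G e) else colour G e)\<rparr>)"

text \<open>The head of the list is the first switch performed.\<close>

definition switch_seq :: "('a \<times> (nat \<Rightarrow> nat)) list \<Rightarrow> 'a ecgraph \<Rightarrow> 'a ecgraph" where
  "switch_seq S G = fold switch S G"

definition switch_equivalent :: "(nat \<Rightarrow> nat) set \<Rightarrow> 'a ecgraph \<Rightarrow> 'b ecgraph \<Rightarrow> bool" where
  "switch_equivalent \<Gamma> G H \<longleftrightarrow>
     (\<exists>S. set S \<subseteq> verts G \<times> \<Gamma> \<and> isomorphic (switch_seq S G) H)"

text \<open>
  The regular \<open>m\<close>-gon is placed in the complex plane, inscribed in the unit circle. The dihedral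
  group consists of the permutations of the vertex labels that are induced by an isometry of the
  plane. As usual for functions that permute \<open>{1..m}\<close>, they fix every number outside \<open>{1..m}\<close>.
\<close>

definition polygon_vertex :: "nat \<Rightarrow> nat \<Rightarrow> complex" where
  "polygon_vertex m i = cis (2 * pi * real i / real m)"

definition plane_isometry :: "(complex \<Rightarrow> complex) \<Rightarrow> bool" where
  "plane_isometry f \<longleftrightarrow> bij f \<and> (\<forall>z w. dist (f z) (f w) = dist z w)"

definition dihedral :: "nat \<Rightarrow> (nat \<Rightarrow> nat) set" where
  "dihedral m =
     (if m = 2 then carrier (sym_group 2)
      else {p \<in> carrier (sym_group m).
              \<exists>f. plane_isometry f \<and>
                  (\<forall>i\<in>{1..m}. f (polygon_vertex m i) = polygon_vertex m (p i))})"

lemma subgroup_dihedral: "subgroup (dihedral m) (sym_group m)"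
proof (cases "m = 2")
  case True
  interpret group "sym_group 2" by (rule sym_group_is_group)
  show ?thesis using True subgroup_self by (simp add: dihedral_def)
next
  case False
  interpret group "sym_group m" by (rule sym_group_is_group)
  let ?R = "\<lambda>p f. plane_isometry f \<and>
              (\<forall>i\<in>{1..m}. f (polygon_vertex m i) = polygon_vertex m (p i))"
  have mem: "p \<in> dihedral m \<longleftrightarrow> p permutes {1..m} \<and> (\<exists>f. ?R p f)" for p
    using False by (simp add: dihedral_def sym_group_carrier)
  show ?thesis
  proof (rule subgroupI)
    show "dihedral m \<subseteq> carrier (sym_group m)"
      by (auto simp: mem sym_group_carrier)
    have "?R id id" by (simp add: plane_isometry_def)
    then show "dihedral m \<noteq> {}" using mem[of id] permutes_id by blast
  next
    fix p assume "p \<in> dihedral m"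
    then obtain f where p: "p permutes {1..m}" and f: "?R p f" by (auto simp: mem)
    have bij: "bij f" using f by (simp add: plane_isometry_def)
    let ?q = "inv' p"
    have q: "?q permutes {1..m}" using p by (rule permutes_inv)
    have "inv' f (polygon_vertex m i) = polygon_vertex m (?q i)" if "i \<in> {1..m}" for i
    proof -
      have "?q i \<in> {1..m}" using q that by (simp only: permutes_in_image)
      then have "f (polygon_vertex m (?q i)) = polygon_vertex m i"
        using f permutes_inverses(1)[OF p] by simp
      then show ?thesis using bij by (metis bij_inv_eq_iff)
    qed
    moreover have "dist (inv' f z) (inv' f w) = dist z w" for z w
      using f bij by (metis plane_isometry_def bij_inv_eq_iff)
    ultimately have "?R ?q (inv' f)"
      using bij_imp_bij_inv[OF bij] by (simp add: plane_isometry_def)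
    then have "?q \<in> dihedral m" using q mem by blast
    moreover have "inv\<^bsub>sym_group m\<^esub> p = ?q"
      using p q permutes_inv_o(2)[OF p]
      by (intro inv_equality) (auto simp: sym_group_carrier sym_group_mult sym_group_one)
    ultimately show "inv\<^bsub>sym_group m\<^esub> p \<in> dihedral m" by simp
  next
    fix p q assume "p \<in> dihedral m" "q \<in> dihedral m"
    then obtain f g where p: "p permutes {1..m}" "?R p f" and q: "q permutes {1..m}" "?R q g"
      by (auto simp: mem)
    have "f (g (polygon_vertex m i)) = polygon_vertex m (p (q i))" if "i \<in> {1..m}" for i
    proof -
      have "q i \<in> {1..m}" using q(1) that by (simp only: permutes_in_image)
      then show ?thesis using p q that by simp
    qed
    then have "?R (p \<circ> q) (f \<circ> g)"
      using p q bij_comp[of g f] by (simp add: plane_isometry_def)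
    then show "p \<otimes>\<^bsub>sym_group m\<^esub> q \<in> dihedral m"
      using mem permutes_compose[OF q(1) p(1)] sym_group_mult by metis
  qed
qed

definition parity_graph :: "'a ecgraph \<Rightarrow> 'a ecgraph" where
  "parity_graph G = G\<lparr>colour := (\<lambda>e. if odd (colour G e) then 1 else 2)\<rparr>"

end

theory Submission
  imports Defs "HOL-Analysis.Complex_Transcendental"
begin

text \<open>
A symmetry of a regular polygon with an even number of vertices either preserves or exchanges the
two alternating classes of vertices. So every permutation in the dihedral group acts on the
parities of the colours as one of the two permutations of \<open>{1, 2}\<close>
(\<open>dihedral_induces_on_parity\<close>), and conversely both of these come from the dihedral group
(\<open>parity_permutation_lifts_to_dihedral\<close>). Taking parities therefore turns a dihedral switching
sequence on \<open>G\<close> into a switching sequence of two colours on the parity graph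
(\<open>parity_graph_switch_seq\<close>), which is one implication, and every sequence on the parity graph
arises in this way.

For the other implication, lift the sequence that makes the parity graphs isomorphic. What remains
is to change the colours of individual edges within their parity class. Let \<open>xy\<close> be an edge and
\<open>\<alpha>\<close>, \<open>\<beta>\<close> two reflections of the polygon. Switch by \<open>\<alpha>\<close> at \<open>x\<close>, by \<open>\<beta>\<close> at \<open>y\<close>, again by
\<open>\<alpha>\<close> at \<open>x\<close> and again by \<open>\<beta>\<close> at \<open>y\<close>. An edge other than \<open>xy\<close> meets at most one of \<open>x\<close> and
\<open>y\<close>, so it is changed by an involution applied twice, hence not at all. The edge \<open>xy\<close> itself is
changed by the square of the rotation that is the product of \<open>\<alpha>\<close> and \<open>\<beta>\<close>, and this can be the
rotation by any even number of steps (\<open>two_reflections_move_colour\<close>). Treating the edges one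
after another gives any colouring with the same parities (\<open>recolour_edges\<close>).
\<close>

section \<open>Dihedral permutations and parity\<close>

lemma sq_dist_cis: "(dist (cis a) (cis b))\<^sup>2 = 2 - 2 * cos (a - b)"
proof -
  have "(dist (cis a) (cis b))\<^sup>2 = (cos a - cos b)\<^sup>2 + (sin a - sin b)\<^sup>2"
    by (simp add: dist_norm cmod_power2)
  also have "\<dots> = ((cos a)\<^sup>2 + (sin a)\<^sup>2) + ((cos b)\<^sup>2 + (sin b)\<^sup>2)
      - 2 * (cos a * cos b + sin a * sin b)"
    by (simp add: power2_eq_square algebra_simps)
  finally show ?thesis by (simp add: cos_diff)
qed

text \<open>
  Two angles with the same cosine agree up to sign and multiples of a full turn. A full turn is
  \<open>m\<close> steps, so parity survives both ambiguities when \<open>m\<close> is even.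
\<close>

lemma even_cos_eq_parity:
  fixes k l :: int
  assumes "m > 0" "even m" and cos: "cos (2 * pi * k / real m) = cos (2 * pi * l / real m)"
  shows "even k \<longleftrightarrow> even l"
proof -
  obtain n :: int where "2 * pi * k / m = 2 * pi * l / m + 2 * n * pi
      \<or> 2 * pi * k / m = - (2 * pi * l / m) + 2 * n * pi"
    using cos unfolding cos_eq Ints_def by (auto simp: algebra_simps)
  then have "2 * pi * real_of_int k = 2 * pi * real_of_int (l + n * int m)
      \<or> 2 * pi * real_of_int k = 2 * pi * real_of_int (- l + n * int m)"
    using \<open>m > 0\<close> by (simp add: field_simps)
  then have "real_of_int k = real_of_int (l + n * int m)
      \<or> real_of_int k = real_of_int (- l + n * int m)"
    by (simp only: mult_cancel_left) simp
  then have "k = l + n * int m \<or> k = - l + n * int m"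
    by (simp only: of_int_eq_iff)
  then show ?thesis using \<open>even m\<close> by auto
qed

lemma dihedral_permutes: "p \<in> dihedral m \<Longrightarrow> p permutes {1..m}"
  by (auto simp: dihedral_def sym_group_carrier split: if_splits)

lemma carrier_sym_group_2: "carrier (sym_group 2) = {id, Transposition.transpose 1 2}"
proof -
  have "{1..2} = {1, 2::nat}" by auto
  then have "carrier (sym_group 2) = {p. p permutes {1, 2}}" by (simp only: sym_group_def) simp
  then show ?thesis by (simp only: permutes_doubleton_iff) blast
qed

text \<open>
  An isometry preserves the distance of the vertices \<open>i\<close> and \<open>j\<close>, which determines the cosine of
  the angle between them and thereby the parity of \<open>i - j\<close>. For \<open>m = 2\<close> the group is by definition
  the full symmetric group, and its two elements are inspected directly.
\<close>

lemma dihedral_parity_diff: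
  assumes p: "p \<in> dihedral m" and "even m" and i: "i \<in> {1..m}" and j: "j \<in> {1..m}"
  shows "(even (p i) \<longleftrightarrow> even (p j)) \<longleftrightarrow> (even i \<longleftrightarrow> even j)"
proof (cases "m = 2")
  case True
  have "p = id \<or> p = Transposition.transpose 1 2"
    using p True carrier_sym_group_2 by (simp add: dihedral_def)
  moreover have "i = 1 \<or> i = 2" "j = 1 \<or> j = 2" using i j True by auto
  ultimately show ?thesis by auto
next
  case False
  then obtain f where iso: "plane_isometry f"
    and f: "\<forall>i\<in>{1..m}. f (polygon_vertex m i) = polygon_vertex m (p i)"
    using p by (auto simp: dihedral_def)
  have "m > 0" using i by simp
  have "dist (polygon_vertex m (p i)) (polygon_vertex m (p j))
      = dist (f (polygon_vertex m i)) (f (polygon_vertex m j))"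
    using f i j by simp
  also have "\<dots> = dist (polygon_vertex m i) (polygon_vertex m j)"
    using iso by (simp add: plane_isometry_def)
  finally have "(dist (polygon_vertex m (p i)) (polygon_vertex m (p j)))\<^sup>2
      = (dist (polygon_vertex m i) (polygon_vertex m j))\<^sup>2" by simp
  then have "cos (2 * pi * real (p i) / m - 2 * pi * real (p j) / m)
      = cos (2 * pi * real i / m - 2 * pi * real j / m)"
    by (simp add: polygon_vertex_def sq_dist_cis)
  then have "cos (2 * pi * real_of_int (int (p i) - int (p j)) / m)
      = cos (2 * pi * real_of_int (int i - int j) / m)"
    by (simp add: diff_divide_distrib right_diff_distrib)
  from even_cos_eq_parity[OF \<open>m > 0\<close> \<open>even m\<close> this] show ?thesis by auto
qed

text \<open>
  The reflection \<open>i \<mapsto> a - i\<close> modulo \<open>m\<close>, with the residues taken in \<open>{1..m}\<close> instead of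
  \<open>{0..<m}\<close>. An integer parameter \<open>a\<close> makes calculations with products of reflections free
  of case distinctions.
\<close>

definition polygon_reflection :: "nat \<Rightarrow> int \<Rightarrow> nat \<Rightarrow> nat" where
  "polygon_reflection m a i =
     (if i \<in> {1..m} then nat ((a - int i - 1) mod int m + 1) else i)"

lemma polygon_reflection_in:
  assumes "i \<in> {1..m}"
  shows "polygon_reflection m a i \<in> {1..m}"
proof -
  have "0 \<le> (a - int i - 1) mod int m" "(a - int i - 1) mod int m < int m"
    using assms by simp_all
  then have "1 \<le> nat ((a - int i - 1) mod int m + 1)" "nat ((a - int i - 1) mod int m + 1) \<le> m"
    by linarith+
  then show ?thesis using assms by (simp add: polygon_reflection_def)
qed

lemma polygon_reflection_cong:
  assumes "i \<in> {1..m}"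
  obtains k where "int (polygon_reflection m a i) = a - int i + k * int m"
proof -
  have "(a - int i - 1) mod int m = (a - int i - 1) - int m * ((a - int i - 1) div int m)"
    by (simp add: minus_mult_div_eq_mod)
  moreover have "(a - int i - 1) mod int m \<ge> 0" using assms by simp
  ultimately have "int (polygon_reflection m a i)
      = a - int i + (- ((a - int i - 1) div int m)) * int m"
    using assms by (simp add: polygon_reflection_def)
  then show thesis by (rule that)
qed

lemma eq_if_cong_in_range:
  assumes "i \<in> {1..m}" "j \<in> {1..m}" "int i = int j + k * int m"
  shows "i = j"
proof -
  have "\<bar>k * int m\<bar> < 1 * int m" using assms by auto
  then have "k = 0" using assms(1)
    by (simp only: abs_mult abs_of_nat mult_less_cancel_right) auto
  then show ?thesis using assms(3) by simp
qed

lemma polygon_reflection_involution [simp]: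
  "polygon_reflection m a (polygon_reflection m a i) = i"
proof (cases "i \<in> {1..m}")
  case True
  note r = polygon_reflection_in[OF True, of a]
  obtain k where k: "int (polygon_reflection m a i) = a - int i + k * int m"
    using polygon_reflection_cong[OF True] by blast
  obtain l where "int (polygon_reflection m a (polygon_reflection m a i))
      = a - int (polygon_reflection m a i) + l * int m"
    using polygon_reflection_cong[OF r] by blast
  with k have "int (polygon_reflection m a (polygon_reflection m a i)) = int i + (l - k) * int m"
    by (simp add: algebra_simps)
  then show ?thesis
    by (rule eq_if_cong_in_range[OF polygon_reflection_in[OF r] True])
next
  case False
  then show ?thesis by (simp only: polygon_reflection_def if_False)
qed

lemma polygon_reflection_permutes: "polygon_reflection m a permutes {1..m}"
proof (rule bij_imp_permutes)
  show "bij_betw (polygon_reflection m a) {1..m} {1..m}"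
    by (rule bij_betw_byWitness[of _ "polygon_reflection m a"])
      (blast intro: polygon_reflection_in polygon_reflection_involution)+
qed (simp only: polygon_reflection_def if_False)

text \<open>
  The axis of this reflection is the line through the origin at half the angle of
  \<open>a\<close> steps: \<open>z\<close> is conjugated and then rotated by \<open>a\<close> steps.
\<close>

lemma polygon_reflection_dihedral: "polygon_reflection m a \<in> dihedral m"
proof (cases "m = 2")
  case True
  then show ?thesis
    using polygon_reflection_permutes[of m a] by (simp add: dihedral_def sym_group_carrier)
next
  case False
  define f where "f z = cis (2 * pi * a / m) * cnj z" for z
  have "f (polygon_vertex m i) = polygon_vertex m (polygon_reflection m a i)"
    if i: "i \<in> {1..m}" for i
  proof -
    obtain k where k: "int (polygon_reflection m a i) = a - int i + k * int m"
      using polygon_reflection_cong[OF i] by blast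
    have "real (polygon_reflection m a i) = of_int a - real i + of_int k * real m"
      using arg_cong[OF k, of real_of_int] by simp
    then have "2 * pi * real (polygon_reflection m a i) / m
        = 2 * pi * (of_int a - real i + of_int k * real m) / m" by simp
    also have "\<dots> = (2 * pi * a / m - 2 * pi * real i / m) + 2 * pi * of_int k"
      using i by (simp add: field_simps)
    finally have "polygon_vertex m (polygon_reflection m a i)
        = cis (2 * pi * a / m - 2 * pi * real i / m) * cis (2 * pi * of_int k)"
      unfolding polygon_vertex_def by (simp only: cis_mult)
    also have "cis (2 * pi * of_int k) = 1" by (simp add: cis_multiple_2pi)
    finally show ?thesis by (simp add: f_def polygon_vertex_def cis_cnj cis_mult)
  qed
  moreover have "plane_isometry f"
  proof -
    have ff: "f (f z) = z" for z
      by (simp add: f_def cis_cnj cis_mult flip: mult.assoc)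
    have "dist (f z) (f w) = dist z w" for z w
    proof -
      have "f z - f w = cis (2 * pi * a / m) * cnj (z - w)"
        by (simp add: f_def right_diff_distrib)
      then show ?thesis by (simp add: dist_norm norm_mult del: complex_cnj_diff)
    qed
    moreover have "f \<circ> f = id" using ff by (simp add: fun_eq_iff)
    ultimately show ?thesis using o_bij[of f f] by (simp add: plane_isometry_def)
  qed
  ultimately show ?thesis
    using False polygon_reflection_permutes[of m a]
    by (auto simp: dihedral_def sym_group_carrier)
qed

text \<open>
  Reflecting by \<open>i \<mapsto> a - i\<close> and then by \<open>i \<mapsto> b - i\<close> is the rotation by \<open>b - a\<close> steps, and
  doing it twice moves \<open>c\<close> to \<open>c + 2 * (b - a)\<close>. An even difference \<open>d - c\<close> is thus reached with
  \<open>a = 0\<close> and \<open>b = (d - c) / 2\<close>.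
\<close>

lemma two_reflections_move_colour:
  assumes c: "c \<in> {1..m}" and d: "d \<in> {1..m}" and par: "even c \<longleftrightarrow> even d"
  obtains a b where "polygon_reflection m b (polygon_reflection m a
    (polygon_reflection m b (polygon_reflection m a c))) = d"
proof -
  define b where "b = (int d - int c) div 2"
  have b: "2 * b = int d - int c" using par by (auto simp: b_def)
  let ?A = "polygon_reflection m 0" and ?B = "polygon_reflection m b"
  note r1 = polygon_reflection_in[OF c, of 0]
  note r2 = polygon_reflection_in[OF r1, of b]
  note r3 = polygon_reflection_in[OF r2, of 0]
  note r4 = polygon_reflection_in[OF r3, of b]
  obtain k1 where "int (?A c) = 0 - int c + k1 * int m"
    using polygon_reflection_cong[OF c] by blast
  moreover obtain k2 where "int (?B (?A c)) = b - int (?A c) + k2 * int m"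
    using polygon_reflection_cong[OF r1] by blast
  moreover obtain k3 where "int (?A (?B (?A c))) = 0 - int (?B (?A c)) + k3 * int m"
    using polygon_reflection_cong[OF r2] by blast
  moreover obtain k4 where "int (?B (?A (?B (?A c)))) = b - int (?A (?B (?A c))) + k4 * int m"
    using polygon_reflection_cong[OF r3] by blast
  ultimately have "int (?B (?A (?B (?A c)))) = int d + (k4 - k3 + k2 - k1) * int m"
    using b by (simp add: algebra_simps)
  from eq_if_cong_in_range[OF r4 d this] show thesis by (rule that)
qed

section \<open>Switching parities\<close>

definition colour_parity :: "nat \<Rightarrow> nat" where
  "colour_parity c = (if odd c then 1 else 2)"

lemma colour_parity_eq_iff: "colour_parity c = colour_parity d \<longleftrightarrow> (even c \<longleftrightarrow> even d)"
  by (simp add: colour_parity_def)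

lemma parity_graph_alt: "parity_graph G = G\<lparr>colour := \<lambda>e. colour_parity (colour G e)\<rparr>"
  by (simp add: parity_graph_def colour_parity_def)

definition induces_on_parity :: "nat \<Rightarrow> (nat \<Rightarrow> nat) \<Rightarrow> (nat \<Rightarrow> nat) \<Rightarrow> bool" where
  "induces_on_parity m p q \<longleftrightarrow> (\<forall>i\<in>{1..m}. colour_parity (p i) = q (colour_parity i))"

text \<open>
  Since relative parities are preserved, the image of the single colour \<open>1\<close> decides whether the
  two parity classes are kept or exchanged.
\<close>

lemma dihedral_induces_on_parity:
  assumes p: "p \<in> dihedral m" and "m \<ge> 2" and "even m"
  shows "\<exists>q\<in>carrier (sym_group 2). induces_on_parity m p q"
proof -
  let ?q = "if even (p 1) then Transposition.transpose 1 2 else id"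
  have "induces_on_parity m p ?q"
    using dihedral_parity_diff[OF p \<open>even m\<close>, of _ 1] \<open>m \<ge> 2\<close>
    by (auto simp: induces_on_parity_def colour_parity_def)
  then show ?thesis by (auto simp: carrier_sym_group_2 split: if_splits)
qed

text \<open>
  The exchange of the parities is induced by any reflection \<open>i \<mapsto> a - i\<close> with \<open>a\<close> odd,
  because reduction modulo the even number \<open>m\<close> does not change parities.
\<close>

lemma parity_permutation_lifts_to_dihedral:
  assumes q: "q \<in> carrier (sym_group 2)" and "even m"
  shows "\<exists>p\<in>dihedral m. induces_on_parity m p q"
proof (cases "q = id")
  case True
  have "id \<in> dihedral m"
    using subgroup.one_closed[OF subgroup_dihedral] by (simp add: sym_group_one)
  then show ?thesis using True by (intro bexI[of _ id]) (simp_all add: induces_on_parity_def)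
next
  case False
  then have q: "q = Transposition.transpose 1 2" using q by (simp add: carrier_sym_group_2)
  have "even (polygon_reflection m 1 i) \<longleftrightarrow> odd i" if i: "i \<in> {1..m}" for i
  proof -
    obtain k where "int (polygon_reflection m 1 i) = 1 - int i + k * int m"
      using polygon_reflection_cong[OF i] by blast
    then have "even (int (polygon_reflection m 1 i)) \<longleftrightarrow> odd (int i)"
      using \<open>even m\<close> by simp
    then show ?thesis by simp
  qed
  then have "induces_on_parity m (polygon_reflection m 1) q"
    by (auto simp: q induces_on_parity_def colour_parity_def)
  then show ?thesis using polygon_reflection_dihedral by blast
qed

section \<open>Switching sequences\<close>

lemma switch_simps [simp]:
  "verts (switch s G) = verts G" "edges (switch s G) = edges G"
  "ecgraph.more (switch s G) = ecgraph.more G"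
  by (auto simp: switch_def split_beta)

lemma colour_switch:
  "colour (switch (x, p) G) e = (if e \<in> edges G \<and> x \<in> e then p (colour G e) else colour G e)"
  by (simp add: switch_def)

lemma switch_seq_simps [simp]:
  "switch_seq [] G = G" "switch_seq (s # S) G = switch_seq S (switch s G)"
  "switch_seq (S @ T) G = switch_seq T (switch_seq S G)"
  by (simp_all add: switch_seq_def)

lemma switch_seq_graph [simp]:
  "verts (switch_seq S G) = verts G" "edges (switch_seq S G) = edges G"
  "ecgraph.more (switch_seq S G) = ecgraph.more G"
  by (induction S arbitrary: G) simp_all

lemma edge_coloured_graph_switch:
  assumes "edge_coloured_graph m G" and p: "p \<in> dihedral m"
  shows "edge_coloured_graph m (switch (x, p) G)"
  using assms permutes_in_image[OF dihedral_permutes[OF p]]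
  by (simp add: edge_coloured_graph_def) (simp add: switch_def)

lemma edge_coloured_graph_switch_seq:
  assumes "edge_coloured_graph m G" and "set S \<subseteq> verts G \<times> dihedral m"
  shows "edge_coloured_graph m (switch_seq S G)"
  using assms by (induction S arbitrary: G) (auto simp: edge_coloured_graph_switch)

lemma parity_graph_switch:
  assumes "edge_coloured_graph m G" and "induces_on_parity m p q"
  shows "parity_graph (switch (x, p) G) = switch (x, q) (parity_graph G)"
  using assms
  by (auto simp: parity_graph_alt switch_def edge_coloured_graph_def induces_on_parity_def
      fun_eq_iff intro!: ecgraph.equality)

text \<open>
  The hypothesis relates the two sequences instead of computing one from the other, so that it
  serves both to project a dihedral sequence to parities and to lift a sequence of parities.
\<close>

lemma parity_graph_switch_seq:
  assumes "edge_coloured_graph m G" and "set S \<subseteq> verts G \<times> dihedral m"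
    and "list_all2 (\<lambda>(x, p) (y, q). x = y \<and> induces_on_parity m p q) S T"
  shows "parity_graph (switch_seq S G) = switch_seq T (parity_graph G)"
  using assms(3,1,2)
proof (induction arbitrary: G rule: list_all2_induct)
  case (Cons s S t T)
  obtain x p q where [simp]: "s = (x, p)" "t = (x, q)" and pq: "induces_on_parity m p q"
    using Cons.hyps by (auto split: prod.splits)
  have "edge_coloured_graph m (switch (x, p) G)"
    using Cons.prems by (auto intro: edge_coloured_graph_switch)
  then show ?case
    using Cons.IH Cons.prems parity_graph_switch[OF Cons.prems(1) pq] by simp
qed simp

lemma isomorphic_parity_graph: "isomorphic G H \<Longrightarrow> isomorphic (parity_graph G) (parity_graph H)"
  by (auto simp: isomorphic_def parity_graph_alt)

section \<open>Recolouring within parity classes\<close>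

text \<open>
  This is the commutator of the switches at the two ends of \<open>e\<close>: it cancels on every edge that
  contains only one of the ends, and in a simple graph no edge but \<open>e\<close> contains both.
\<close>

lemma recolour_edge:
  assumes G: "edge_coloured_graph m G" and e: "e \<in> edges G"
    and d: "d \<in> {1..m}" "even (colour G e) \<longleftrightarrow> even d"
  shows "\<exists>S. set S \<subseteq> verts G \<times> dihedral m
    \<and> switch_seq S G = G\<lparr>colour := (colour G)(e := d)\<rparr>"
proof -
  have "card e = 2" "e \<subseteq> verts G" "colour G e \<in> {1..m}"
    using G e by (auto simp: edge_coloured_graph_def)
  then obtain x y where xy: "e = {x, y}" "x \<noteq> y" by (auto simp: card_2_iff)
  obtain a b where ab: "polygon_reflection m b (polygon_reflection m a
      (polygon_reflection m b (polygon_reflection m a (colour G e)))) = d"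
    using two_reflections_move_colour[OF \<open>colour G e \<in> {1..m}\<close> d] by blast
  let ?A = "polygon_reflection m a" and ?B = "polygon_reflection m b"
  let ?S = "[(x, ?A), (y, ?B), (x, ?A), (y, ?B)]"
  have only_e: "e' = e" if "e' \<in> edges G" "x \<in> e'" "y \<in> e'" for e'
  proof -
    have "card e' = 2" using G that by (auto simp: edge_coloured_graph_def)
    then show ?thesis using that xy by (auto simp: card_2_iff)
  qed
  have "colour (switch_seq ?S G) = (colour G)(e := d)"
  proof
    fix e'
    show "colour (switch_seq ?S G) e' = ((colour G)(e := d)) e'"
    proof (cases "e' = e")
      case True
      then show ?thesis using ab e xy by (simp add: colour_switch)
    next
      case False
      then consider "e' \<notin> edges G" | "x \<notin> e'" | "y \<notin> e'"
        using only_e by blast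
      then show ?thesis using False by cases (simp_all add: colour_switch)
    qed
  qed
  then have "switch_seq ?S G = G\<lparr>colour := (colour G)(e := d)\<rparr>"
    by (intro ecgraph.equality) (simp_all del: switch_seq_simps)
  moreover have "set ?S \<subseteq> verts G \<times> dihedral m"
    using \<open>e \<subseteq> verts G\<close> xy polygon_reflection_dihedral by auto
  ultimately show ?thesis by blast
qed

lemma recolour_edges:
  assumes "finite F" and G: "edge_coloured_graph m G" and F: "F \<subseteq> edges G"
    and K: "\<forall>e\<in>F. K e \<in> {1..m} \<and> (even (colour G e) \<longleftrightarrow> even (K e))"
  shows "\<exists>S. set S \<subseteq> verts G \<times> dihedral m
    \<and> switch_seq S G = G\<lparr>colour := \<lambda>e. if e \<in> F then K e else colour G e\<rparr>"
  using assms(1) F K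
proof (induction F)
  case empty
  show ?case by (intro exI[of _ "[]"]) simp
next
  case (insert e F)
  then obtain S where S: "set S \<subseteq> verts G \<times> dihedral m"
    "switch_seq S G = G\<lparr>colour := \<lambda>e. if e \<in> F then K e else colour G e\<rparr>" by auto
  let ?G = "switch_seq S G"
  have "edge_coloured_graph m ?G"
    using G S(1) by (rule edge_coloured_graph_switch_seq)
  moreover have "even (colour ?G e) \<longleftrightarrow> even (K e)"
    using insert S(2) by simp
  ultimately obtain T where T: "set T \<subseteq> verts G \<times> dihedral m"
    "switch_seq T ?G = ?G\<lparr>colour := (colour ?G)(e := K e)\<rparr>"
    using recolour_edge[of m ?G e "K e"] insert.prems by auto
  have "switch_seq (S @ T) G
      = G\<lparr>colour := \<lambda>e'. if e' \<in> insert e F then K e' else colour G e'\<rparr>"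
    by (auto simp: T(2)) (auto simp: S(2) fun_eq_iff intro!: ecgraph.equality)
  then show ?case using S(1) T(1) by (intro exI[of _ "S @ T"]) auto
qed

text \<open>
  Pull the colours of \<open>H\<close> back along an isomorphism of the parity graphs. The resulting colouring of
  \<open>G\<close> has the same parities as the given one, so it can be reached edge by edge.
\<close>

lemma dihedral_switch_equivalent_if_parity_isomorphic:
  assumes G: "edge_coloured_graph m G" and H: "edge_coloured_graph m H"
    and iso: "isomorphic (parity_graph G) (parity_graph H)"
  shows "switch_equivalent (dihedral m) G H"
proof -
  obtain f where f: "bij_betw f (verts G) (verts H)"
    and adj: "\<forall>x\<in>verts G. \<forall>y\<in>verts G. {x, y} \<in> edges G \<longleftrightarrow> {f x, f y} \<in> edges H"
    and par: "\<forall>x\<in>verts G. \<forall>y\<in>verts G. {x, y} \<in> edges G \<longrightarrow>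
      colour_parity (colour H {f x, f y}) = colour_parity (colour G {x, y})"
    using iso by (auto simp: isomorphic_def parity_graph_alt)
  have "finite (edges G)"
    using G by (auto simp: edge_coloured_graph_def intro: finite_subset[of _ "Pow (verts G)"])
  moreover have "colour H (f ` e) \<in> {1..m} \<and> (even (colour G e) \<longleftrightarrow> even (colour H (f ` e)))"
    if eG: "e \<in> edges G" for e
  proof -
    have "card e = 2" "e \<subseteq> verts G" using G eG by (auto simp: edge_coloured_graph_def)
    then obtain x y where e: "e = {x, y}" "x \<in> verts G" "y \<in> verts G"
      by (auto simp: card_2_iff)
    then have "f ` e \<in> edges H" using adj eG by auto
    moreover have "colour_parity (colour H (f ` e)) = colour_parity (colour G e)"
      using par e eG by auto
    ultimately show ?thesis
      using H by (auto simp: edge_coloured_graph_def colour_parity_eq_iff)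
  qed
  ultimately obtain S where S: "set S \<subseteq> verts G \<times> dihedral m"
    "switch_seq S G = G\<lparr>colour := \<lambda>e. if e \<in> edges G then colour H (f ` e) else colour G e\<rparr>"
    using recolour_edges[OF _ G subset_refl, of "\<lambda>e. colour H (f ` e)"] by auto
  have "isomorphic (switch_seq S G) H"
    unfolding isomorphic_def S(2) using f adj by (intro exI[of _ f]) auto
  then show ?thesis using S(1) by (auto simp: switch_equivalent_def)
qed

lemma switch_equivalent_trans_switch_seq:
  assumes "set S \<subseteq> verts G \<times> \<Gamma>" and "switch_equivalent \<Gamma> (switch_seq S G) H"
  shows "switch_equivalent \<Gamma> G H"
proof -
  obtain T where "set T \<subseteq> verts G \<times> \<Gamma>" "isomorphic (switch_seq T (switch_seq S G)) H"
    using assms(2) by (auto simp: switch_equivalent_def)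
  then show ?thesis
    using assms(1) unfolding switch_equivalent_def by (intro exI[of _ "S @ T"]) auto
qed

theorem theorem3p4:
  fixes m :: nat and G :: "'a ecgraph" and H :: "'b ecgraph"
  assumes "m \<ge> 2" and "even m"
    and "edge_coloured_graph m G" and "edge_coloured_graph m H"
  shows "switch_equivalent (dihedral m) G H \<longleftrightarrow>
         switch_equivalent (carrier (sym_group 2)) (parity_graph G) (parity_graph H)"
proof
  assume "switch_equivalent (dihedral m) G H"
  then obtain S where S: "set S \<subseteq> verts G \<times> dihedral m" and iso: "isomorphic (switch_seq S G) H"
    by (auto simp: switch_equivalent_def)
  obtain h where h: "\<And>p. p \<in> dihedral m \<Longrightarrow> h p \<in> carrier (sym_group 2) \<and> induces_on_parity m p (h p)"
    using dihedral_induces_on_parity[OF _ assms(1,2)] by metis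
  let ?T = "map (\<lambda>(x, p). (x, h p)) S"
  have "list_all2 (\<lambda>(x, p) (y, q). x = y \<and> induces_on_parity m p q) S ?T"
    using S h by (auto simp: list_all2_map2 intro!: list.rel_refl_strong)
  then have "parity_graph (switch_seq S G) = switch_seq ?T (parity_graph G)"
    by (rule parity_graph_switch_seq[OF assms(3) S])
  then have "isomorphic (switch_seq ?T (parity_graph G)) (parity_graph H)"
    using isomorphic_parity_graph[OF iso] by simp
  moreover have "set ?T \<subseteq> verts (parity_graph G) \<times> carrier (sym_group 2)"
    using S h by (auto simp: parity_graph_alt)
  ultimately show "switch_equivalent (carrier (sym_group 2)) (parity_graph G) (parity_graph H)"
    unfolding switch_equivalent_def by blast
next
  assume "switch_equivalent (carrier (sym_group 2)) (parity_graph G) (parity_graph H)"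
  then obtain T where T: "set T \<subseteq> verts G \<times> carrier (sym_group 2)"
    and iso: "isomorphic (switch_seq T (parity_graph G)) (parity_graph H)"
    by (auto simp: switch_equivalent_def parity_graph_alt)
  obtain h where h: "\<And>q. q \<in> carrier (sym_group 2) \<Longrightarrow> h q \<in> dihedral m \<and> induces_on_parity m (h q) q"
    using parity_permutation_lifts_to_dihedral[OF _ assms(2)] by metis
  let ?S = "map (\<lambda>(x, q). (x, h q)) T"
  have S: "set ?S \<subseteq> verts G \<times> dihedral m" using T h by auto
  have "list_all2 (\<lambda>(x, p) (y, q). x = y \<and> induces_on_parity m p q) ?S T"
    using T h by (auto simp: list_all2_map1 intro!: list.rel_refl_strong)
  then have "parity_graph (switch_seq ?S G) = switch_seq T (parity_graph G)"
    by (rule parity_graph_switch_seq[OF assms(3) S])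
  then have "isomorphic (parity_graph (switch_seq ?S G)) (parity_graph H)"
    using iso by simp
  then have "switch_equivalent (dihedral m) (switch_seq ?S G) H"
    by (rule dihedral_switch_equivalent_if_parity_isomorphic
        [OF edge_coloured_graph_switch_seq[OF assms(3) S] assms(4)])
  then show "switch_equivalent (dihedral m) G H"
    by (rule switch_equivalent_trans_switch_seq[OF S])
qed

end
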